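(* Let $G$ be a connected graph on $n$ vertices with colouring $\omega$ from colour-set $C$. Then, for any $d\in C$, $$m(G,\omega,d)\ \le\ n-N_d(G,\omega).$$
   Context: All graphs are finite and simple. $N_d(G,\omega)$ denotes the number of vertices $v$ of $G$ with $\omega(v)=d$. The (free) Flood-It game: let $G=(V,E)$ be a graph with a colouring $\omega:V\to C$, not necessarily proper, where $C$ is a finite colour-set. A monochromatic component is a maximal set of vertices of one colour inducing a connected subgraph. A move $(v,d)$, with $v\in V$ and $d\in C$, recolours with colour $d$ every vertex in the monochromatic component (with respect to the current colouring) containing $v$. For $d\in C$, $m(G,\omega,d)$ is the minimum number of moves needed, starting from $\omega$, to give all vertices of $G$ colour $d$. *)

theory Defs
  imports "Graph_Theory.Digraph_Component" "HOL-Library.Extended_Nat"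
begin

text \<open>
  Finite simple graphs are the locale \<^const>\<open>graph\<close>: finite, symmetric, loop-free digraphs without
  parallel arcs. A colouring is a function on the vertex type; only its values on
  \<^term>\<open>verts G\<close> matter.
\<close>

definition connected_monochromatic ::
    "('a, 'b) pre_digraph \<Rightarrow> ('a \<Rightarrow> 'c) \<Rightarrow> 'a set \<Rightarrow> bool" where
  "connected_monochromatic G \<omega> S \<longleftrightarrow>
     S \<subseteq> verts G \<and> connected (G \<restriction> S) \<and> (\<exists>c. \<forall>v\<in>S. \<omega> v = c)"

definition monochromatic_component ::
    "('a, 'b) pre_digraph \<Rightarrow> ('a \<Rightarrow> 'c) \<Rightarrow> 'a set \<Rightarrow> bool" where
  "monochromatic_component G \<omega> S \<longleftrightarrow>
     connected_monochromatic G \<omega> S \<and>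
     (\<forall>T. connected_monochromatic G \<omega> T \<and> S \<subseteq> T \<longrightarrow> T = S)"

definition flood :: "('a, 'b) pre_digraph \<Rightarrow> 'a \<times> 'c \<Rightarrow> ('a \<Rightarrow> 'c) \<Rightarrow> ('a \<Rightarrow> 'c)" where
  "flood G mv \<omega> = (case mv of (v, d) \<Rightarrow>
     (\<lambda>u. if \<exists>S. monochromatic_component G \<omega> S \<and> v \<in> S \<and> u \<in> S then d else \<omega> u))"

definition floods_to ::
    "('a, 'b) pre_digraph \<Rightarrow> 'c set \<Rightarrow> ('a \<Rightarrow> 'c) \<Rightarrow> 'c \<Rightarrow> ('a \<times> 'c) list \<Rightarrow> bool" where
  "floods_to G C \<omega> d mvs \<longleftrightarrow>
     set mvs \<subseteq> verts G \<times> C \<and> (\<forall>v\<in>verts G. fold (flood G) mvs \<omega> v = d)"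

text \<open>
  The minimum is taken in \<^typ>\<open>enat\<close>, so it would be infinite if no sequence of moves worked;
  a finite upper bound therefore includes the existence of a flooding sequence.
\<close>

definition min_moves ::
    "('a, 'b) pre_digraph \<Rightarrow> 'c set \<Rightarrow> ('a \<Rightarrow> 'c) \<Rightarrow> 'c \<Rightarrow> enat" where
  "min_moves G C \<omega> d = (INF mvs \<in> {mvs. floods_to G C \<omega> d mvs}. enat (length mvs))"

definition num_coloured :: "('a, 'b) pre_digraph \<Rightarrow> ('a \<Rightarrow> 'c) \<Rightarrow> 'c \<Rightarrow> nat" where
  "num_coloured G \<omega> d = card {v \<in> verts G. \<omega> v = d}"

end

theory Submission
  imports Defs
begin

text \<open>Repeatedly flood, with colour \<open>d\<close>, the component of some vertex not yet coloured \<open>d\<close>: that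
  vertex acquires colour \<open>d\<close> and no vertex loses it, so the number of vertices of other colours
  strictly decreases.\<close>

lemma connected_monochromatic_singleton:
  assumes "v \<in> verts G"
  shows "connected_monochromatic G \<omega> {v}"
  unfolding connected_monochromatic_def connected_def strongly_connected_def
  using assms by (auto simp: reachable_def)

text \<open>Starting from the singleton \<open>{v}\<close>, finiteness yields a maximal connected
  monochromatic set above it. This is what makes a move effective: \<open>flood\<close> recolours
  \<open>v\<close> only if some component contains \<open>v\<close>.\<close>

lemma monochromatic_component_exists:
  assumes "finite (verts G)" and "v \<in> verts G"
  shows "\<exists>S. monochromatic_component G \<omega> S \<and> v \<in> S"
proof -
  have "finite {S. connected_monochromatic G \<omega> S}"
    by (rule finite_subset[of _ "Pow (verts G)"])
      (use assms(1) in \<open>auto simp: connected_monochromatic_def\<close>)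
  then obtain S where "connected_monochromatic G \<omega> S" "{v} \<subseteq> S"
    and "\<forall>T. connected_monochromatic G \<omega> T \<and> S \<subseteq> T \<longrightarrow> T = S"
    using finite_has_maximal2[of "{S. connected_monochromatic G \<omega> S}" "{v}"]
      connected_monochromatic_singleton[OF assms(2), of \<omega>] by auto
  then show ?thesis
    unfolding monochromatic_component_def by blast
qed

text \<open>The length is only bounded, not fixed, because one move may recolour many vertices. The
  induction varies the colouring, since the remaining moves start from the flooded one.\<close>

lemma exists_flooding_sequence:
  assumes "finite (verts G)" and "d \<in> C"
  shows "\<exists>mvs. floods_to G C \<omega> d mvs \<and> length mvs \<le> card {v \<in> verts G. \<omega> v \<noteq> d}"
proof (induction "card {v \<in> verts G. \<omega> v \<noteq> d}" arbitrary: \<omega> rule: less_induct)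
  case less
  show ?case
  proof (cases "\<exists>v\<in>verts G. \<omega> v \<noteq> d")
    case False
    then show ?thesis
      by (intro exI[of _ "[]"]) (auto simp: floods_to_def)
  next
    case True
    then obtain v where v: "v \<in> verts G" "\<omega> v \<noteq> d" by blast
    let ?\<omega>' = "flood G (v, d) \<omega>"
    have "?\<omega>' v = d"
      using monochromatic_component_exists[OF assms(1) v(1), of \<omega>] by (auto simp: flood_def)
    \<comment> \<open>Both branches of \<open>flood\<close> give \<open>d\<close> here, so it does
      not matter whether \<open>u\<close> lies in the flooded component.\<close>
    moreover have "?\<omega>' u = d" if "\<omega> u = d" for u
      using that by (simp add: flood_def)
    ultimately have "{u \<in> verts G. ?\<omega>' u \<noteq> d} \<subset> {u \<in> verts G. \<omega> u \<noteq> d}"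
      using v by blast
    then have decr: "card {u \<in> verts G. ?\<omega>' u \<noteq> d} < card {u \<in> verts G. \<omega> u \<noteq> d}"
      using assms(1) by (intro psubset_card_mono) auto
    from less[OF this] obtain mvs where "floods_to G C ?\<omega>' d mvs"
      and "length mvs \<le> card {u \<in> verts G. ?\<omega>' u \<noteq> d}" by blast
    \<comment> \<open>\<open>fold\<close> applies the head of the list first, so
      \<open>(v, d)\<close> is played before \<open>mvs\<close>; the strict decrease
      \<open>decr\<close> pays for this extra move.\<close>
    then show ?thesis
      using decr v(1) assms(2) by (intro exI[of _ "(v, d) # mvs"]) (auto simp: floods_to_def)
  qed
qed

theorem proposition2p7:
  fixes G :: "('a, 'b) pre_digraph" and C :: "'c set" and \<omega> :: "'a \<Rightarrow> 'c"
    and n :: nat and d :: 'c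
  assumes "graph G" and "connected G" and "card (verts G) = n"
    and "finite C" and "\<omega> ` verts G \<subseteq> C" and "d \<in> C"
  shows "min_moves G C \<omega> d \<le> enat (n - num_coloured G \<omega> d)"
proof -
  interpret graph G by fact
  obtain mvs where mvs: "floods_to G C \<omega> d mvs" "length mvs \<le> card {v \<in> verts G. \<omega> v \<noteq> d}"
    using exists_flooding_sequence[OF finite_verts assms(6)] by blast
  have "{v \<in> verts G. \<omega> v \<noteq> d} = verts G - {v \<in> verts G. \<omega> v = d}" by blast
  then have "card {v \<in> verts G. \<omega> v \<noteq> d} = n - num_coloured G \<omega> d"
    using assms(3) by (simp add: num_coloured_def card_Diff_subset)
  \<comment> \<open>Any single flooding sequence bounds the infimum from above.\<close>
  then show ?thesis
    unfolding min_moves_def using mvs by (intro INF_lower2[of mvs]) auto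
qed

end
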